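(* For every translation triangle $A_1A_2A_3$ in $\widetilde{\mathrm{SL}_2(\mathbb R)}$ geometry with interior angles $\omega_1,\omega_2,\omega_3$, one has $\omega_1+\omega_2+\omega_3\ge\pi$.
   Context: Model of the space. Let $\mathcal H$ be the set of points $(x^0:x^1:x^2:x^3)$ (homogeneous coordinates up to positive multiples, i.e. points of the projective sphere) with $-x^0x^0-x^1x^1+x^2x^2+x^3x^3<0$, and let $E_0=(1:0:0:0)$ be the origin. Normalizing this form to $-1$, points of $\mathcal H$ are parametrized by $x^0=\cosh r\cos\phi$, $x^1=\cosh r\sin\phi$, $x^2=\sinh r\cos(\theta-\phi)$, $x^3=\sinh r\sin(\theta-\phi)$. Letting $\phi$ range over all of $\mathbb R$ one obtains the universal cover $\widetilde{\mathcal H}$ of $\mathcal H$; with the Riemannian metric $$(ds)^2=(dr)^2+\cosh^2 r\,\sinh^2 r\,(d\theta)^2+\big[d\phi+\sinh^2 r\,d\theta\big]^2$$ this is the space $\widetilde{\mathrm{SL}_2(\mathbb R)}$. Translations. For $X=(x^0:x^1:x^2:x^3)\in\mathcal H$ the translation carrying $E_0$ to $X$ is the map acting on row vectors from the right by the matrix $$\mathbf T_X=\begin{pmatrix} x^0&x^1&x^2&x^3\\ -x^1&x^0&x^3&-x^2\\ x^2&x^3&x^0&x^1\\ x^3&-x^2&-x^1&x^0\end{pmatrix};$$ translations lift to $\widetilde{\mathcal H}$ and act there by isometries of the Riemannian metric $(ds)^2=(dr)^2+\cosh^2 r\,\sinh^2 r\,(d\theta)^2+\big[d\phi+\sinh^2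 r\,d\theta\big]^2$. Translation curves. A curve $\mathcal C(t)=(x^0(t):x^1(t):x^2(t):x^3(t))$, $t\ge 0$, with $\mathcal C(0)=E_0$ is a translation curve if $\dot{\mathcal C}(0)\cdot\mathbf T_{\mathcal C(t)}=\dot{\mathcal C}(t)$ for all $t\ge0$ (lifted to $\widetilde{\mathcal H}$). Translation curves starting at another point $P$ are the images of translation curves starting at $E_0$ under the translation carrying $E_0$ to $P$. In the inhomogeneous coordinates $x=x^1/x^0$, $y=x^2/x^0$, $z=x^3/x^0$ translation curves are straight lines. Translation triangles. A translation triangle with pairwise distinct vertices $A_1,A_2,A_3$ consists of the parts of translation curves joining each pair of vertices (the sides). The interior angle $\omega_i\in[0,\pi]$ at $A_i$ is the Riemannian angle, with respect to the metric $(ds)^2=(dr)^2+\cosh^2 r\,\sinh^2 r\,(d\theta)^2+\big[d\phi+\sinh^2 r\,d\theta\big]^2$ on $\widetilde{\mathcal H}$, between the tangent vectors at $A_i$ of the two sides meeting at $A_i$, both oriented away from $A_i$. *)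

theory Defs
  imports "HOL-Analysis.Analysis"
begin

section \<open>The hyperboloid and its universal cover\<close>

text \<open>
  A point of the projective sphere on which the form is negative has exactly one positive
  multiple on which the form equals -1; it is represented by that vector. The components
  \<open>x\<^sup>0, x\<^sup>1, x\<^sup>2, x\<^sup>3\<close> are \<open>x $ 1, x $ 2, x $ 3, x $ 4\<close>.
\<close>

definition sl2_form :: "real^4 \<Rightarrow> real" where
  "sl2_form x = - ((x$1)^2) - (x$2)^2 + (x$3)^2 + (x$4)^2"

definition sl2_hyperboloid :: "(real^4) set" where
  "sl2_hyperboloid = {x. sl2_form x = -1}"

definition sl2_E0 :: "real^4" where
  "sl2_E0 = vector [1, 0, 0, 0]"

text \<open>
  The universal cover is a copy of \<open>\<complex> \<times> \<real>\<close>: the point with coordinates \<open>(r, \<theta>, \<phi>)\<close>, where \<open>r \<ge> 0\<close>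
  and \<open>\<phi>\<close> ranges over all reals, is the pair \<open>(u, \<phi>)\<close> with \<open>u = sinh r * cis \<theta>\<close>. Hence
  \<open>sinh r = \<bar>u\<bar>\<close> and \<open>cosh r = sqrt (1 + \<bar>u\<bar>\<^sup>2)\<close>, and the chart stays smooth on the axis \<open>r = 0\<close>.
  A tangent vector is likewise a pair \<open>(du, d\<phi>)\<close>.
\<close>

type_synonym sl2_cover = "complex \<times> real"

definition sl2_origin :: sl2_cover where
  "sl2_origin = (0, 0)"

definition sl2_cyl :: "real \<Rightarrow> real \<Rightarrow> real \<Rightarrow> sl2_cover" where
  "sl2_cyl r \<theta> \<phi> = (of_real (sinh r) * cis \<theta>, \<phi>)"

definition sl2_proj :: "sl2_cover \<Rightarrow> real^4" where
  "sl2_proj P = (let u = fst P; \<phi> = snd P; w = u * cis (- \<phi>) in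
     vector [sqrt (1 + (cmod u)^2) * cos \<phi>, sqrt (1 + (cmod u)^2) * sin \<phi>, Re w, Im w])"

section \<open>The Riemannian metric\<close>

text \<open>The differentials of \<open>r = arsinh \<bar>u\<bar>\<close> and of \<open>\<theta> = arg u\<close> at \<open>u \<noteq> 0\<close>, evaluated at \<open>du\<close>.\<close>

definition sl2_dr :: "complex \<Rightarrow> complex \<Rightarrow> real" where
  "sl2_dr u du = (u \<bullet> du) / (cmod u * sqrt (1 + (cmod u)^2))"

definition sl2_dtheta :: "complex \<Rightarrow> complex \<Rightarrow> real" where
  "sl2_dtheta u du = Im (cnj u * du) / (cmod u)^2"

text \<open>
  The polarization of \<open>dr\<^sup>2 + cosh\<^sup>2 r sinh\<^sup>2 r d\<theta>\<^sup>2 + (d\<phi> + sinh\<^sup>2 r d\<theta>)\<^sup>2\<close>. On the axis \<open>u = 0\<close>, where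
  \<open>\<theta>\<close> is undefined, it is the smooth extension (see \<open>sl2_metric_smooth\<close> below).
\<close>

definition sl2_metric :: "sl2_cover \<Rightarrow> sl2_cover \<Rightarrow> sl2_cover \<Rightarrow> real" where
  "sl2_metric P v w =
    (let u = fst P; r = arsinh (cmod u) in
     if u = 0 then fst v \<bullet> fst w + snd v * snd w
     else sl2_dr u (fst v) * sl2_dr u (fst w)
        + (cosh r)^2 * (sinh r)^2 * (sl2_dtheta u (fst v) * sl2_dtheta u (fst w))
        + (snd v + (sinh r)^2 * sl2_dtheta u (fst v)) * (snd w + (sinh r)^2 * sl2_dtheta u (fst w)))"

definition sl2_angle :: "sl2_cover \<Rightarrow> sl2_cover \<Rightarrow> sl2_cover \<Rightarrow> real" where
  "sl2_angle P v w =
    arccos (sl2_metric P v w / (sqrt (sl2_metric P v v) * sqrt (sl2_metric P w w)))"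

section \<open>Translations and translation curves\<close>

definition sl2_T :: "real^4 \<Rightarrow> real^4^4" where
  "sl2_T x = vector
    [vector [x$1, x$2, x$3, x$4],
     vector [- x$2, x$1, x$4, - x$3],
     vector [x$3, x$4, x$1, x$2],
     vector [x$4, - x$3, - x$2, x$1]]"

text \<open>
  \<open>\<tau>\<close> is the translation of the cover that carries the origin to \<open>P\<close>, i.e. the continuous
  lift of \<open>Y \<mapsto> Y v* sl2_T (sl2_proj P)\<close> with that value at the origin
  (it exists uniquely: \<open>sl2_translation_ex1\<close> below).
\<close>

definition sl2_translation :: "sl2_cover \<Rightarrow> (sl2_cover \<Rightarrow> sl2_cover) \<Rightarrow> bool" where
  "sl2_translation P \<tau> \<longleftrightarrow>
     continuous_on UNIV \<tau> \<and> \<tau> sl2_origin = P \<and>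
     (\<forall>Y. sl2_proj (\<tau> Y) = sl2_proj Y v* sl2_T (sl2_proj P))"

text \<open>Curves are total functions on the reals, of which only the values on \<open>{0..}\<close> matter.\<close>

definition hyperboloid_translation_curve :: "(real \<Rightarrow> real^4) \<Rightarrow> bool" where
  "hyperboloid_translation_curve C \<longleftrightarrow>
     (\<forall>t\<ge>0. C t \<in> sl2_hyperboloid) \<and> C 0 = sl2_E0 \<and>
     (\<exists>V. (C has_vector_derivative V) (at 0 within {0..}) \<and>
          (\<forall>t\<ge>0. (C has_vector_derivative (V v* sl2_T (C t))) (at t within {0..})))"

definition translation_curve_from_origin :: "(real \<Rightarrow> sl2_cover) \<Rightarrow> bool" where
  "translation_curve_from_origin c \<longleftrightarrow>
     continuous_on {0..} c \<and> c 0 = sl2_origin \<and>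
     hyperboloid_translation_curve (\<lambda>t. sl2_proj (c t))"

definition translation_curve :: "sl2_cover \<Rightarrow> (real \<Rightarrow> sl2_cover) \<Rightarrow> bool" where
  "translation_curve P c \<longleftrightarrow>
     (\<exists>\<tau> c0. sl2_translation P \<tau> \<and> translation_curve_from_origin c0 \<and>
             (\<forall>t\<ge>0. c t = \<tau> (c0 t)))"

section \<open>Translation triangles\<close>

text \<open>
  A side from \<open>P\<close> to \<open>Q\<close> is a pair \<open>(c, L)\<close>: the restriction to \<open>{0..L}\<close> of a translation
  curve \<open>c\<close> starting at \<open>P\<close> with \<open>c L = Q\<close>. It is part of the data of a triangle, because two
  points of the cover may be joined by no translation curve or by several.
\<close>

type_synonym sl2_side = "(real \<Rightarrow> sl2_cover) \<times> real"

definition translation_side :: "sl2_cover \<Rightarrow> sl2_cover \<Rightarrow> sl2_side \<Rightarrow> bool" where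
  "translation_side P Q s \<longleftrightarrow> translation_curve P (fst s) \<and> 0 < snd s \<and> fst s (snd s) = Q"

text \<open>Tangent vectors at the two end points of a side, both pointing into the side.\<close>

definition side_tangent_start :: "sl2_side \<Rightarrow> sl2_cover" where
  "side_tangent_start s = vector_derivative (fst s) (at 0 within {0..snd s})"

definition side_tangent_end :: "sl2_side \<Rightarrow> sl2_cover" where
  "side_tangent_end s = - vector_derivative (fst s) (at (snd s) within {0..snd s})"

definition translation_triangle ::
  "sl2_cover \<Rightarrow> sl2_cover \<Rightarrow> sl2_cover \<Rightarrow> sl2_side \<Rightarrow> sl2_side \<Rightarrow> sl2_side \<Rightarrow> bool" where
  "translation_triangle A1 A2 A3 s12 s23 s31 \<longleftrightarrow>
     A1 \<noteq> A2 \<and> A2 \<noteq> A3 \<and> A3 \<noteq> A1 \<and>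
     translation_side A1 A2 s12 \<and> translation_side A2 A3 s23 \<and> translation_side A3 A1 s31"

text \<open>The interior angle at \<open>A\<close>, for a side \<open>s_in\<close> that ends at \<open>A\<close> and a side \<open>s_out\<close> that starts at \<open>A\<close>.\<close>

definition interior_angle :: "sl2_cover \<Rightarrow> sl2_side \<Rightarrow> sl2_side \<Rightarrow> real" where
  "interior_angle A s_in s_out = sl2_angle A (side_tangent_end s_in) (side_tangent_start s_out)"

section \<open>The definitions against the coordinate formulas\<close>

lemma vector_4_nth [simp]:
  "(vector [a, b, c, d] :: 'a::zero^4) $ 1 = a"
  "(vector [a, b, c, d] :: 'a::zero^4) $ 2 = b"
  "(vector [a, b, c, d] :: 'a::zero^4) $ 3 = c"
  "(vector [a, b, c, d] :: 'a::zero^4) $ 4 = d"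
  unfolding vector_def by auto

lemma sl2_proj_nth:
  "sl2_proj P $ 1 = sqrt (1 + (cmod (fst P))^2) * cos (snd P)"
  "sl2_proj P $ 2 = sqrt (1 + (cmod (fst P))^2) * sin (snd P)"
  "sl2_proj P $ 3 = Re (fst P * cis (- snd P))"
  "sl2_proj P $ 4 = Im (fst P * cis (- snd P))"
  unfolding sl2_proj_def Let_def by (simp_all only: vector_4_nth)

lemma sl2_proj_origin: "sl2_proj sl2_origin = sl2_E0"
  unfolding sl2_proj_def sl2_origin_def sl2_E0_def by simp

lemma sl2_proj_cyl:
  "sl2_proj (sl2_cyl r \<theta> \<phi>) =
     vector [cosh r * cos \<phi>, cosh r * sin \<phi>, sinh r * cos (\<theta> - \<phi>), sinh r * sin (\<theta> - \<phi>)]"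
proof -
  have "sqrt (1 + (sinh r)^2) = cosh r"
    by (metis add.commute cosh_real_nonneg cosh_square_eq real_sqrt_unique)
  moreover have "of_real (sinh r) * cis \<theta> * cis (- \<phi>) = of_real (sinh r) * cis (\<theta> - \<phi>)"
    by (simp add: cis_mult mult.assoc)
  ultimately show ?thesis
    unfolding sl2_proj_def Let_def sl2_cyl_def
    by (simp add: norm_mult cos_diff sin_diff algebra_simps)
qed

lemma sl2_cyl_surj: "\<exists>r\<ge>0. \<exists>\<theta>. P = sl2_cyl r \<theta> (snd P)"
proof -
  have "P = sl2_cyl (arsinh (cmod (fst P))) (Arg (fst P)) (snd P)"
    unfolding sl2_cyl_def by (cases P) (simp add: rcis_def[symmetric] rcis_cmod_Arg)
  moreover have "arsinh (cmod (fst P)) \<ge> 0"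
    by (metis norm_ge_zero sinh_arsinh_real sinh_real_nonneg_iff)
  ultimately show ?thesis by blast
qed

lemma range_sl2_proj: "range sl2_proj = sl2_hyperboloid"
proof
  show "range sl2_proj \<subseteq> sl2_hyperboloid"
  proof
    fix x assume "x \<in> range sl2_proj"
    then obtain P where P: "x = sl2_proj P" by blast
    define w where "w = fst P * cis (- snd P)"
    have "(Re w)^2 + (Im w)^2 = (cmod (fst P))^2"
      unfolding cmod_power2[symmetric] w_def by (simp only: norm_mult norm_cis mult_1_right)
    moreover have "(sqrt (1 + (cmod (fst P))^2) * cos (snd P))^2
          + (sqrt (1 + (cmod (fst P))^2) * sin (snd P))^2 = 1 + (cmod (fst P))^2"
      by (simp add: power_mult_distrib flip: distrib_left)
    ultimately show "x \<in> sl2_hyperboloid"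
      unfolding sl2_hyperboloid_def sl2_form_def P mem_Collect_eq sl2_proj_nth w_def[symmetric]
      by linarith
  qed
  show "sl2_hyperboloid \<subseteq> range sl2_proj"
  proof
    fix x assume "x \<in> sl2_hyperboloid"
    then have x: "(x$1)^2 + (x$2)^2 = 1 + ((x$3)^2 + (x$4)^2)"
      unfolding sl2_hyperboloid_def sl2_form_def by simp
    define a where "a = Complex (x$1) (x$2)"
    define P where "P = (Complex (x$3) (x$4) * cis (Arg a), Arg a)"
    have "cmod (fst P) = cmod (Complex (x$3) (x$4))"
      unfolding P_def fst_conv norm_mult norm_cis by simp
    then have "cmod a = sqrt (1 + (cmod (fst P))^2)"
      unfolding a_def by (simp add: cmod_def x)
    moreover have "a = of_real (cmod a) * cis (Arg a)"
      by (metis rcis_cmod_Arg rcis_def)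
    then have "Re a = cmod a * cos (Arg a)" "Im a = cmod a * sin (Arg a)"
      by (metis Re_complex_of_real Im_complex_of_real Re_rcis Im_rcis rcis_def)+
    moreover have "fst P * cis (- snd P) = Complex (x$3) (x$4)"
      unfolding P_def by (simp add: mult.assoc cis_mult)
    moreover have "snd P = Arg a" "Re a = x$1" "Im a = x$2" by (simp_all add: P_def a_def)
    ultimately have "x = sl2_proj P"
      unfolding vec_eq_iff forall_4 sl2_proj_nth by (metis complex.sel)
    then show "x \<in> range sl2_proj" by blast
  qed
qed

lemma sl2_T_row: "sl2_E0 v* sl2_T x = x"
  unfolding vec_eq_iff forall_4 vector_matrix_mult_def sl2_E0_def sl2_T_def
  by (simp add: sum_4)

lemma sl2_metric_smooth:
  "sl2_metric (u, \<phi>) (du, d\<phi>) (du', d\<phi>') =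
     du \<bullet> du' - (u \<bullet> du) * (u \<bullet> du') / (1 + (cmod u)^2)
     + Im (cnj u * du) * Im (cnj u * du')
     + (d\<phi> + Im (cnj u * du)) * (d\<phi>' + Im (cnj u * du'))"
proof (cases "u = 0")
  case True
  then show ?thesis by (simp add: sl2_metric_def)
next
  case False
  define s where "s = (cmod u)^2"
  have s: "s > 0" using False by (simp add: s_def)
  have ch: "(cosh (arsinh (cmod u)))^2 = 1 + s"
    by (simp add: cosh_square_eq s_def)
  have dr: "sl2_dr u du * sl2_dr u du' = (u \<bullet> du) * (u \<bullet> du') / (s * (1 + s))"
  proof -
    have "(cmod u * sqrt (1 + s)) * (cmod u * sqrt (1 + s)) = s * (1 + s)"
      using s by (simp add: s_def power2_eq_square[symmetric] power_mult_distrib)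
    then show ?thesis unfolding sl2_dr_def s_def[symmetric] by simp
  qed
  have key: "(u \<bullet> du) * (u \<bullet> du') + Im (cnj u * du) * Im (cnj u * du') = s * (du \<bullet> du')"
    unfolding s_def cmod_power2 inner_complex_def by (simp add: power2_eq_square algebra_simps)
  then have key': "(u \<bullet> du) * (u \<bullet> du') = s * (du \<bullet> du') - Im (cnj u * du) * Im (cnj u * du')"
    by simp
  have "(u \<bullet> du) * (u \<bullet> du') / (s * (1 + s))
        + (1 + s) * s * (Im (cnj u * du) / s * (Im (cnj u * du') / s))
      = du \<bullet> du' - (u \<bullet> du) * (u \<bullet> du') / (1 + s) + Im (cnj u * du) * Im (cnj u * du')"
  proof -
    have "1 + s \<noteq> 0" using s by simp
    then show ?thesis using s unfolding key' by (simp add: divide_simps) algebra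
  qed
  then show ?thesis
    using False s unfolding sl2_metric_def Let_def fst_conv snd_conv dr ch sl2_dtheta_def
      s_def[symmetric] sinh_arsinh_real
    by simp
qed

text \<open>The squared speed of a curve given in the coordinates \<open>(r, \<theta>, \<phi>)\<close>.\<close>

lemma sl2_metric_cyl:
  assumes r: "(r has_real_derivative dr) (at t)" and th: "(\<theta> has_real_derivative d\<theta>) (at t)"
    and ph: "(\<phi> has_real_derivative d\<phi>) (at t)" and pos: "r t > 0"
  shows "\<exists>v. ((\<lambda>t. sl2_cyl (r t) (\<theta> t) (\<phi> t)) has_vector_derivative v) (at t) \<and>
    sl2_metric (sl2_cyl (r t) (\<theta> t) (\<phi> t)) v v =
      dr^2 + (cosh (r t))^2 * (sinh (r t))^2 * d\<theta>^2 + (d\<phi> + (sinh (r t))^2 * d\<theta>)^2"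
proof -
  define S where "S = sinh (r t)"
  define C where "C = cosh (r t)"
  have S: "S > 0" and C: "C > 0" and CS: "C^2 = 1 + S^2"
    using pos by (simp_all add: S_def C_def cosh_square_eq)
  define du where "du = Complex (C * dr * cos (\<theta> t) - S * (sin (\<theta> t) * d\<theta>))
                                (C * dr * sin (\<theta> t) + S * (cos (\<theta> t) * d\<theta>))"
  define u where "u = of_real S * cis (\<theta> t)"
  have cyl: "sl2_cyl (r t) (\<theta> t) (\<phi> t)
      = (Complex (sinh (r t) * cos (\<theta> t)) (sinh (r t) * sin (\<theta> t)), \<phi> t)" for t
    unfolding sl2_cyl_def by (simp add: complex_eq_iff)
  have "((\<lambda>t. sl2_cyl (r t) (\<theta> t) (\<phi> t)) has_vector_derivative (du, d\<phi>)) (at t)"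
    unfolding cyl
  proof (rule has_vector_derivative_Pair)
    show "(\<phi> has_vector_derivative d\<phi>) (at t)"
      using ph by (simp add: has_real_derivative_iff_has_vector_derivative)
    have 1: "((\<lambda>t. sinh (r t) * cos (\<theta> t)) has_real_derivative Re du) (at t)"
      unfolding du_def S_def C_def by (auto intro!: derivative_eq_intros r th)
    have 2: "((\<lambda>t. sinh (r t) * sin (\<theta> t)) has_real_derivative Im du) (at t)"
      unfolding du_def S_def C_def by (auto intro!: derivative_eq_intros r th)
    show "((\<lambda>t. Complex (sinh (r t) * cos (\<theta> t)) (sinh (r t) * sin (\<theta> t)))
            has_vector_derivative du) (at t)"
      using 1 2 unfolding has_vector_derivative_complex_iff
      by simp
  qed
  moreover have "sl2_metric (sl2_cyl (r t) (\<theta> t) (\<phi> t)) (du, d\<phi>) (du, d\<phi>)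
      = dr^2 + C^2 * S^2 * d\<theta>^2 + (d\<phi> + S^2 * d\<theta>)^2"
  proof -
    define c where "c = cos (\<theta> t)"
    define s where "s = sin (\<theta> t)"
    have t1: "c^2 + s^2 = 1" by (simp add: c_def s_def)
    have u': "u = Complex (S * c) (S * s)"
      unfolding u_def c_def s_def by (simp add: complex_eq_iff)
    have du': "du = Complex (C * dr * c - S * (s * d\<theta>)) (C * dr * s + S * (c * d\<theta>))"
      unfolding du_def c_def s_def by simp
    have m: "cmod u = S" unfolding u_def using S by (simp add: norm_mult)
    have i: "u \<bullet> du = S * C * dr"
    proof -
      have "u \<bullet> du = S * C * dr * (c^2 + s^2)"
        unfolding u' du' inner_complex_def by (simp add: algebra_simps power2_eq_square)
      then show ?thesis unfolding t1 by simp
    qed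
    have j: "Im (cnj u * du) = S^2 * d\<theta>"
    proof -
      have "Im (cnj u * du) = S^2 * d\<theta> * (c^2 + s^2)"
        unfolding u' du' by (simp add: algebra_simps power2_eq_square)
      then show ?thesis unfolding t1 by simp
    qed
    have k: "du \<bullet> du = C^2 * dr^2 + S^2 * d\<theta>^2"
    proof -
      have "du \<bullet> du = (C^2 * dr^2 + S^2 * d\<theta>^2) * (c^2 + s^2)"
        unfolding du' inner_complex_def by (simp add: algebra_simps power2_eq_square)
      then show ?thesis unfolding t1 by simp
    qed
    have l: "(S * C * dr) * (S * C * dr) / C^2 = S^2 * dr^2"
      using C by (simp add: power2_eq_square)
    have pt: "sl2_cyl (r t) (\<theta> t) (\<phi> t) = (u, \<phi> t)" by (simp add: sl2_cyl_def u_def S_def)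
    then show ?thesis
      unfolding pt sl2_metric_smooth m i j k CS[symmetric] l
      unfolding CS by (simp add: power2_eq_square algebra_simps)
  qed
  ultimately show ?thesis unfolding S_def C_def by blast
qed

text \<open>
  Existence and uniqueness of the lifted translations. With \<open>a = x\<^sup>0 + i x\<^sup>1\<close> and \<open>b = x\<^sup>2 + i x\<^sup>3\<close>
  the row-vector action of \<open>sl2_T\<close> is the multiplication of \<open>SU(1,1)\<close>.
\<close>

definition sl2_a :: "sl2_cover \<Rightarrow> complex" where
  "sl2_a P = of_real (sqrt (1 + (cmod (fst P))^2)) * cis (snd P)"

definition sl2_b :: "sl2_cover \<Rightarrow> complex" where
  "sl2_b P = fst P * cis (- snd P)"

lemma sl2_proj_ab:
  "sl2_proj P $ 1 = Re (sl2_a P)" "sl2_proj P $ 2 = Im (sl2_a P)"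
  "sl2_proj P $ 3 = Re (sl2_b P)" "sl2_proj P $ 4 = Im (sl2_b P)"
  unfolding sl2_proj_nth sl2_a_def sl2_b_def by simp_all

lemma sl2_proj_eq_iff: "sl2_proj P = sl2_proj Q \<longleftrightarrow> sl2_a P = sl2_a Q \<and> sl2_b P = sl2_b Q"
  unfolding vec_eq_iff forall_4 sl2_proj_ab complex_eq_iff by blast

lemma sl2_proj_T_iff:
  "sl2_proj P = sl2_proj Q v* sl2_T (sl2_proj R) \<longleftrightarrow>
     sl2_a P = sl2_a Q * sl2_a R + cnj (sl2_b Q) * sl2_b R \<and>
     sl2_b P = cnj (sl2_a Q) * sl2_b R + sl2_b Q * sl2_a R"
proof -
  have 1: "(sl2_proj Q v* sl2_T (sl2_proj R)) $ 1 = Re (sl2_a Q * sl2_a R + cnj (sl2_b Q) * sl2_b R)"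
    and 2: "(sl2_proj Q v* sl2_T (sl2_proj R)) $ 2 = Im (sl2_a Q * sl2_a R + cnj (sl2_b Q) * sl2_b R)"
    and 3: "(sl2_proj Q v* sl2_T (sl2_proj R)) $ 3 = Re (cnj (sl2_a Q) * sl2_b R + sl2_b Q * sl2_a R)"
    and 4: "(sl2_proj Q v* sl2_T (sl2_proj R)) $ 4 = Im (cnj (sl2_a Q) * sl2_b R + sl2_b Q * sl2_a R)"
    unfolding vector_matrix_mult_def sl2_T_def
    by (simp_all add: sum_4 sl2_proj_ab)
  show ?thesis
    unfolding vec_eq_iff forall_4 1 2 3 4 sl2_proj_ab complex_eq_iff by blast
qed

lemma norm_sl2_a: "cmod (sl2_a P) = sqrt (1 + (cmod (sl2_b P))^2)"
  unfolding sl2_a_def sl2_b_def by (simp add: norm_mult)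

lemma sl2_proj_eq_imp:
  assumes "sl2_proj P = sl2_proj Q"
  shows "\<exists>n::int. snd P - snd Q = 2 * pi * n"
proof -
  have ab: "sl2_a P = sl2_a Q" "sl2_b P = sl2_b Q" using assms by (simp_all add: sl2_proj_eq_iff)
  have "cmod (fst P) = cmod (fst Q)"
    using arg_cong[OF ab(2), of cmod] by (simp add: sl2_b_def norm_mult)
  moreover have "sqrt (1 + (cmod (fst Q))^2) \<noteq> 0"
    by (metis add_pos_nonneg less_numeral_extra(1,3) real_sqrt_eq_zero_cancel_iff zero_le_power2)
  ultimately have "cis (snd P) = cis (snd Q)"
    using ab(1) unfolding sl2_a_def by simp
  then have "cis (snd P - snd Q) = 1"
    by (simp flip: cis_divide)
  then have "cos (snd P - snd Q) = 1" by (metis cis.sel(1) one_complex.sel(1))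
  then obtain n :: int where "snd P - snd Q = real_of_int n * 2 * pi"
    using cos_one_2pi_int by blast
  then show ?thesis by (intro exI[of _ n]) simp
qed

lemma sl2_translation_exists: "\<exists>\<tau>. sl2_translation P \<tau>"
proof -
  define z where "z Y = 1 + cnj (sl2_b Y) * sl2_b P / (sl2_a Y * sl2_a P)" for Y
  define A where "A Y = sl2_a Y * sl2_a P + cnj (sl2_b Y) * sl2_b P" for Y
  define B where "B Y = cnj (sl2_a Y) * sl2_b P + sl2_b Y * sl2_a P" for Y
  define \<psi> where "\<psi> Y = snd Y + snd P + Arg (z Y)" for Y
  define \<tau> where "\<tau> Y = (B Y * cis (\<psi> Y), \<psi> Y)" for Y
  have less: "cmod (sl2_b Q) < cmod (sl2_a Q)" for Q
    unfolding norm_sl2_a by (rule real_less_rsqrt) simp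
  have a0: "sl2_a Q \<noteq> 0" for Q using less[of Q] by auto
  have zp: "Re (z Y) > 0" for Y
  proof -
    have "cmod (sl2_b Y) * cmod (sl2_b P) < cmod (sl2_a Y) * cmod (sl2_a P)"
      using less[of Y] less[of P] by (intro mult_strict_mono) (auto intro: le_less_trans[OF norm_ge_zero])
    then have "cmod (cnj (sl2_b Y) * sl2_b P / (sl2_a Y * sl2_a P)) < 1"
      using a0 by (simp add: norm_mult norm_divide)
    then show ?thesis
      using abs_Re_le_cmod[of "cnj (sl2_b Y) * sl2_b P / (sl2_a Y * sl2_a P)"]
      unfolding z_def by simp
  qed
  have Aeq: "A Y = sl2_a Y * sl2_a P * z Y" for Y
    unfolding A_def z_def using a0[of Y] a0[of P] by (simp add: field_simps)
  have norm_A: "cmod (A Y) = sqrt (1 + (cmod (B Y))^2)" for Y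
  proof -
    have *: "(cmod (sl2_a Q))^2 = 1 + (cmod (sl2_b Q))^2" for Q
      unfolding norm_sl2_a by simp
    have "(cmod (A Y))^2 - (cmod (B Y))^2
        = ((cmod (sl2_a Y))^2 - (cmod (sl2_b Y))^2) * ((cmod (sl2_a P))^2 - (cmod (sl2_b P))^2)"
      unfolding A_def B_def cmod_power2 by simp algebra
    then have "(cmod (A Y))^2 = 1 + (cmod (B Y))^2" unfolding * by simp
    then show ?thesis by (metis norm_ge_zero real_sqrt_unique)
  qed
  have cisA: "of_real (cmod (A Y)) * cis (\<psi> Y) = A Y" for Y
  proof -
    have a: "sl2_a Q = of_real (cmod (sl2_a Q)) * cis (snd Q)" for Q
      unfolding norm_sl2_a by (simp add: sl2_a_def sl2_b_def norm_mult)
    have "z Y = of_real (cmod (z Y)) * cis (Arg (z Y))"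
      by (metis rcis_cmod_Arg rcis_def)
    then have "A Y = of_real (cmod (sl2_a Y)) * cis (snd Y) * (of_real (cmod (sl2_a P)) * cis (snd P))
        * (of_real (cmod (z Y)) * cis (Arg (z Y)))"
      unfolding Aeq using a by metis
    also have "\<dots> = of_real (cmod (A Y)) * (cis (snd Y) * cis (snd P) * cis (Arg (z Y)))"
      unfolding Aeq norm_mult by simp
    also have "\<dots> = of_real (cmod (A Y)) * cis (\<psi> Y)"
      by (simp add: cis_mult \<psi>_def)
    finally show ?thesis by simp
  qed
  have a\<tau>: "sl2_a (\<tau> Y) = A Y" for Y
    using cisA[of Y] unfolding sl2_a_def \<tau>_def norm_A by (simp add: norm_mult)
  have b\<tau>: "sl2_b (\<tau> Y) = B Y" for Y
    unfolding sl2_b_def \<tau>_def by (simp add: mult.assoc cis_mult)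
  have conta: "continuous_on UNIV sl2_a" and contb: "continuous_on UNIV sl2_b"
    unfolding sl2_a_def sl2_b_def cis_conv_exp by (intro continuous_intros)+
  have contz: "continuous_on UNIV z"
    unfolding z_def using a0 by (intro continuous_intros conta contb) auto
  have nz: "z Y \<notin> \<real>\<^sub>\<le>\<^sub>0" for Y
    using zp[of Y] by (auto simp: complex_nonpos_Reals_iff)
  have cont\<psi>: "continuous_on UNIV \<psi>"
    unfolding \<psi>_def using nz by (intro continuous_intros contz) auto
  have "continuous_on UNIV \<tau>"
    unfolding \<tau>_def B_def cis_conv_exp by (intro continuous_intros cont\<psi> conta contb)
  moreover have "\<tau> sl2_origin = P"
  proof -
    have "sl2_a sl2_origin = 1" "sl2_b sl2_origin = 0"
      by (simp_all add: sl2_a_def sl2_b_def sl2_origin_def)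
    then have "z sl2_origin = 1" "B sl2_origin = sl2_b P" by (simp_all add: z_def B_def)
    then show ?thesis
      unfolding \<tau>_def \<psi>_def
      by (simp add: sl2_origin_def sl2_b_def mult.assoc cis_mult)
  qed
  moreover have "sl2_proj (\<tau> Y) = sl2_proj Y v* sl2_T (sl2_proj P)" for Y
    unfolding sl2_proj_T_iff a\<tau> b\<tau> A_def B_def by simp
  ultimately show ?thesis unfolding sl2_translation_def by blast
qed

lemma sl2_translation_unique:
  assumes "sl2_translation P \<sigma>" "sl2_translation P \<tau>"
  shows "\<sigma> = \<tau>"
proof -
  have pr: "sl2_proj (\<sigma> Y) = sl2_proj (\<tau> Y)" for Y
    using assms unfolding sl2_translation_def by metis
  define d where "d Y = snd (\<sigma> Y) - snd (\<tau> Y)" for Y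
  have "d constant_on UNIV"
  proof (rule continuous_discrete_range_constant)
    show "continuous_on UNIV d"
      using assms unfolding d_def sl2_translation_def by (intro continuous_intros) auto
    fix X :: sl2_cover
    have "2 * pi \<le> norm (d Y - d X)" if ne: "d Y \<noteq> d X" for Y
    proof -
      obtain m n :: int where mn: "d Y = 2 * pi * m" "d X = 2 * pi * n"
        unfolding d_def using sl2_proj_eq_imp[OF pr] by blast
      then have "1 \<le> \<bar>m - n\<bar>" using ne by auto
      then have "1 \<le> \<bar>real_of_int m - real_of_int n\<bar>" by linarith
      moreover have "norm (d Y - d X) = 2 * pi * \<bar>real_of_int m - real_of_int n\<bar>"
        unfolding mn by (simp add: abs_mult flip: right_diff_distrib)
      ultimately show ?thesis by simp
    qed
    then show "\<exists>e>0. \<forall>Y. Y \<in> UNIV \<and> d Y \<noteq> d X \<longrightarrow> e \<le> norm (d Y - d X)"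
      by (intro exI[of _ "2 * pi"]) auto
  qed (rule connected_UNIV)
  moreover have "d sl2_origin = 0"
    using assms unfolding d_def sl2_translation_def by simp
  ultimately have "d Y = 0" for Y
    unfolding constant_on_def by (metis UNIV_I)
  then have s: "snd (\<sigma> Y) = snd (\<tau> Y)" for Y by (simp add: d_def)
  moreover have "fst (\<sigma> Y) = fst (\<tau> Y)" for Y
    using pr[of Y] s[of Y] by (simp add: sl2_proj_eq_iff sl2_b_def)
  ultimately show ?thesis by (intro ext prod_eqI)
qed

lemma sl2_translation_ex1: "\<exists>!\<tau>. sl2_translation P \<tau>"
  using sl2_translation_exists sl2_translation_unique by blast

end

theory Submission
  imports Defs
begin

text \<open>
  The points of the hyperboloid form the group \<open>SU(1,1)\<close>, the translation carrying the origin to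
  \<open>P\<close> is right multiplication by \<open>P\<close>, and the translation curves from the origin are its
  one-parameter subgroups. A translation curve from \<open>P\<close> is therefore \<open>t \<mapsto> exp (t w) P\<close> (lifted to
  the cover), an integral curve of the right-invariant vector field with value \<open>w\<close> at the origin.
  The metric is right-invariant as well. So if each tangent space is identified with the one at the
  origin by means of translations, the identification is isometric and each side has a constant
  velocity vector.

  Let \<open>u\<close>, \<open>v\<close>, \<open>w\<close> be the three vectors at the origin that belong to the sides \<open>A1 A2\<close>, \<open>A2 A3\<close>
  and \<open>A3 A1\<close>. The interior angle at \<open>A1\<close> is the Euclidean angle between \<open>- w\<close> and \<open>u\<close>, that is \<open>\<pi>\<close>
  minus the angle between \<open>w\<close> and \<open>u\<close>, and likewise at the other vertices. Hence the angle sum is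
  \<open>3\<pi>\<close> minus the sum of the three mutual angles of \<open>u\<close>, \<open>v\<close>, \<open>w\<close>. Three vectors of an inner product
  space have mutual angles of total at most \<open>2\<pi>\<close> (\<open>vec_angle_sum_le\<close>), which gives the bound \<open>\<pi>\<close>.

  The identification of tangent spaces is \<open>sl2_frame\<close>: \<open>sl2_metric_frame\<close> says that it is isometric,
  and \<open>frame_velocity\<close> that it makes velocities constant. The latter requires the derivative
  of a curve in the cover, of which the definition only controls the projection to the
  hyperboloid; \<open>continuous_lift_has_vector_derivative\<close> recovers it.
\<close>

section \<open>Angles in a real inner product space\<close>

text \<open>
  The formula is the one in \<open>sl2_angle\<close>. In particular, a zero vector has the angle
  \<open>arccos 0 = \<pi> / 2\<close> with every vector, because division by zero gives zero.
\<close>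

definition vec_angle :: "'a::real_inner \<Rightarrow> 'a \<Rightarrow> real" where
  "vec_angle u v = arccos (u \<bullet> v / (norm u * norm v))"

lemma normalized_inner_bounds:
  "-1 \<le> u \<bullet> v / (norm u * norm v)" "u \<bullet> v / (norm u * norm v) \<le> 1"
proof -
  have "\<bar>u \<bullet> v / (norm u * norm v)\<bar> \<le> 1"
  proof (cases "u = 0 \<or> v = 0")
    case False
    then have "norm u * norm v > 0" by simp
    then show ?thesis
      using Cauchy_Schwarz_ineq2[of u v] by (simp add: abs_divide)
  qed auto
  then show "-1 \<le> u \<bullet> v / (norm u * norm v)" "u \<bullet> v / (norm u * norm v) \<le> 1"
    by linarith+
qed

lemma vec_angle_bounds: "0 \<le> vec_angle u v" "vec_angle u v \<le> pi"
  unfolding vec_angle_def by (intro arccos_lbound arccos_ubound normalized_inner_bounds)+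

lemma vec_angle_minus_left: "vec_angle (- u) v = pi - vec_angle u v"
  using arccos_minus[OF normalized_inner_bounds, of u v] by (simp add: vec_angle_def)

lemma cos_vec_angle: "cos (vec_angle u v) = sgn u \<bullet> sgn v"
  using cos_arccos[OF normalized_inner_bounds, of u v]
  by (simp add: vec_angle_def sgn_div_norm divide_inverse mult_ac)

text \<open>
  The inner product of \<open>u\<close> and \<open>w\<close> is the sum of that of their components along \<open>v\<close> and that of
  their components orthogonal to \<open>v\<close>. For unit vectors the bound says that the angle between \<open>u\<close>
  and \<open>w\<close> has a cosine of at least \<open>cos (\<alpha> + \<beta>)\<close>, where \<open>\<alpha>\<close> and \<open>\<beta>\<close> are the angles with \<open>v\<close>.
\<close>

lemma inner_ge_of_unit_middle:
  fixes u v w :: "'a::real_inner"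
  assumes u: "norm u \<le> 1" and v: "norm v = 1" and w: "norm w \<le> 1"
  shows "u \<bullet> w \<ge> (u \<bullet> v) * (v \<bullet> w) - sqrt (1 - (u \<bullet> v)^2) * sqrt (1 - (v \<bullet> w)^2)"
proof -
  have vv: "v \<bullet> v = 1" using v by (simp add: dot_square_norm)
  define orth where "orth x = x - (x \<bullet> v) *\<^sub>R v" for x
  have norm_orth: "norm (orth x) \<le> sqrt (1 - (x \<bullet> v)^2)" if "norm x \<le> 1" for x
  proof -
    have "x \<bullet> x \<le> 1" using that by (simp add: dot_square_norm power_le_one)
    moreover have "orth x \<bullet> orth x = x \<bullet> x - (x \<bullet> v)^2"
      unfolding orth_def by (simp add: inner_diff vv inner_commute power2_eq_square)
    ultimately show ?thesis by (simp add: norm_eq_sqrt_inner)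
  qed
  have "\<bar>orth u \<bullet> orth w\<bar> \<le> norm (orth u) * norm (orth w)"
    by (rule Cauchy_Schwarz_ineq2)
  also have "\<dots> \<le> sqrt (1 - (u \<bullet> v)^2) * sqrt (1 - (w \<bullet> v)^2)"
    by (intro mult_mono norm_orth u w norm_ge_zero order_trans[OF norm_ge_zero norm_orth])
  finally have "orth u \<bullet> orth w \<ge> - (sqrt (1 - (u \<bullet> v)^2) * sqrt (1 - (w \<bullet> v)^2))"
    by linarith
  moreover have "orth u \<bullet> orth w = u \<bullet> w - (u \<bullet> v) * (w \<bullet> v)"
    unfolding orth_def by (simp add: inner_diff vv inner_commute)
  ultimately show ?thesis by (simp add: inner_commute[of v w])
qed

text \<open>
  On the unit sphere this is the bound \<open>2\<pi>\<close> on the perimeter of a triangle. Only if the first two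
  angles exceed \<open>\<pi>\<close> in total is there something to show about the third.
\<close>

lemma vec_angle_sum_le:
  fixes u v w :: "'a::real_inner"
  shows "vec_angle u v + vec_angle v w + vec_angle w u \<le> 2 * pi"
proof (cases "v = 0 \<or> vec_angle u v + vec_angle v w \<le> pi")
  case True
  have "vec_angle u v + vec_angle v w \<le> pi"
    using True by (auto simp: vec_angle_def)
  then show ?thesis using vec_angle_bounds(2)[of w u] by linarith
next
  case False
  define \<alpha> where "\<alpha> = vec_angle u v"
  define \<beta> where "\<beta> = vec_angle v w"
  have sin_eq: "sin (vec_angle x y) = sqrt (1 - (sgn x \<bullet> sgn y)^2)" for x y :: 'a
    unfolding cos_vec_angle[symmetric]
    by (intro sin_cos_sqrt sin_ge_zero vec_angle_bounds)
  have le1: "norm (sgn x) \<le> 1" for x :: 'a by (simp add: norm_sgn)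
  have "cos (\<alpha> + \<beta>) \<le> sgn u \<bullet> sgn w"
    unfolding cos_add \<alpha>_def \<beta>_def cos_vec_angle sin_eq
    using False by (intro inner_ge_of_unit_middle le1) (simp add: norm_sgn)
  then have "cos (2 * pi - (\<alpha> + \<beta>)) \<le> cos (vec_angle w u)"
    by (simp add: cos_vec_angle inner_commute)
  moreover have "0 \<le> 2 * pi - (\<alpha> + \<beta>)" "2 * pi - (\<alpha> + \<beta>) \<le> pi"
    using False vec_angle_bounds[of u v] vec_angle_bounds[of v w]
    unfolding \<alpha>_def \<beta>_def by linarith+
  ultimately have "vec_angle w u \<le> 2 * pi - (\<alpha> + \<beta>)"
    using vec_angle_bounds[of w u] cos_mono_le_eq by blast
  then show ?thesis unfolding \<alpha>_def \<beta>_def by linarith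
qed

section \<open>The invariant frame\<close>

text \<open>
  The right-invariant vector field through the tangent vector \<open>w\<close> at the origin, evaluated at \<open>P\<close>.
  Its formula comes from the right translation of \<open>w = (\<beta>, v)\<close>, which is \<open>a' = i v a + cnj \<beta> b\<close> and
  \<open>b' = - i v b + \<beta> a\<close> in terms of the matrix entries \<open>a = \<rho> cis \<phi>\<close> and \<open>b = u cis (- \<phi>)\<close> of \<open>P\<close>,
  solved for the velocities of \<open>u\<close> and \<open>\<phi>\<close>.
\<close>

definition sl2_frame :: "sl2_cover \<Rightarrow> complex \<times> real \<Rightarrow> sl2_cover" where
  "sl2_frame P w =
    (let u = fst P; \<rho> = sqrt (1 + (cmod u)^2); \<gamma> = fst w * cis (2 * snd P); m = Im (cnj \<gamma> * u) / \<rho>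
     in (of_real \<rho> * \<gamma> + \<i> * of_real m * u, snd w + m))"

lemma sl2_frame_minus: "sl2_frame P (- w) = - sl2_frame P w"
  unfolding sl2_frame_def Let_def by (simp add: prod_eq_iff diff_divide_distrib algebra_simps
      del: times_complex.sel)

text \<open>
  Right-invariance of the metric. Besides \<open>\<rho>\<^sup>2 = 1 + \<bar>u\<bar>\<^sup>2\<close>, two cancellations make it work: the term
  \<open>i m u\<close> is orthogonal to \<open>u\<close>, so that the radial part only sees \<open>\<rho> \<gamma>\<close>, and \<open>Im (cnj u * du) = - m\<close>, so
  that the last summand of the metric reduces to the product of the \<open>v\<close>-components.
\<close>

lemma sl2_metric_frame: "sl2_metric P (sl2_frame P v) (sl2_frame P w) = v \<bullet> w"
proof -
  define \<rho> where "\<rho> = sqrt (1 + (cmod (fst P))^2)"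
  obtain x y where xy: "fst P = Complex x y" by (cases "fst P")
  have \<rho>2: "\<rho>^2 = 1 + x^2 + y^2" by (simp add: \<rho>_def xy cmod_power2)
  have \<rho>0: "\<rho> > 0" unfolding \<rho>_def by (simp add: add_pos_nonneg)
  have core: "sl2_metric (Complex x y, snd P)
       (of_real \<rho> * \<gamma> + \<i> * of_real (Im (cnj \<gamma> * Complex x y) / \<rho>) * Complex x y,
          a + Im (cnj \<gamma> * Complex x y) / \<rho>)
       (of_real \<rho> * \<delta> + \<i> * of_real (Im (cnj \<delta> * Complex x y) / \<rho>) * Complex x y,
          b + Im (cnj \<delta> * Complex x y) / \<rho>) = \<gamma> \<bullet> \<delta> + a * b" for \<gamma> \<delta> a b
  proof -
    obtain g1 g2 d1 d2 where gd: "\<gamma> = Complex g1 g2" "\<delta> = Complex d1 d2"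
      by (meson complex.exhaust)
    define m where "m = (g1 * y - g2 * x) / \<rho>"
    define n where "n = (d1 * y - d2 * x) / \<rho>"
    have mn: "g1 * y - g2 * x = \<rho> * m" "d1 * y - d2 * x = \<rho> * n"
      using \<rho>0 by (simp_all add: m_def n_def)
    have im: "Im (cnj \<gamma> * Complex x y) / \<rho> = m" "Im (cnj \<delta> * Complex x y) / \<rho> = n"
      by (simp_all add: gd m_def n_def)
    have du: "of_real \<rho> * \<gamma> + \<i> * of_real m * Complex x y = Complex (\<rho> * g1 - m * y) (\<rho> * g2 + m * x)"
      "of_real \<rho> * \<delta> + \<i> * of_real n * Complex x y = Complex (\<rho> * d1 - n * y) (\<rho> * d2 + n * x)"
      by (simp_all add: complex_eq_iff gd)
    have rad: "Complex x y \<bullet> Complex (\<rho> * g1 - m * y) (\<rho> * g2 + m * x) = \<rho> * (x * g1 + y * g2)"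
      "Complex x y \<bullet> Complex (\<rho> * d1 - n * y) (\<rho> * d2 + n * x) = \<rho> * (x * d1 + y * d2)"
      by (simp_all add: inner_complex_def algebra_simps)
    have rot: "Im (cnj (Complex x y) * Complex (\<rho> * g1 - m * y) (\<rho> * g2 + m * x)) = - m"
      "Im (cnj (Complex x y) * Complex (\<rho> * d1 - n * y) (\<rho> * d2 + n * x)) = - n"
    proof -
      have "x * (\<rho> * g2 + m * x) - y * (\<rho> * g1 - m * y) = (x^2 + y^2) * m - \<rho> * (g1 * y - g2 * x)"
        "x * (\<rho> * d2 + n * x) - y * (\<rho> * d1 - n * y) = (x^2 + y^2) * n - \<rho> * (d1 * y - d2 * x)"
        by algebra+
      then have "x * (\<rho> * g2 + m * x) - y * (\<rho> * g1 - m * y) = (x^2 + y^2) * m - \<rho>^2 * m"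
        "x * (\<rho> * d2 + n * x) - y * (\<rho> * d1 - n * y) = (x^2 + y^2) * n - \<rho>^2 * n"
        unfolding mn by (simp_all add: power2_eq_square)
      then show "Im (cnj (Complex x y) * Complex (\<rho> * g1 - m * y) (\<rho> * g2 + m * x)) = - m"
        "Im (cnj (Complex x y) * Complex (\<rho> * d1 - n * y) (\<rho> * d2 + n * x)) = - n"
        unfolding \<rho>2 by (simp_all add: algebra_simps)
    qed
    have cm: "1 + (cmod (Complex x y))^2 = \<rho>^2" by (simp add: \<rho>2 cmod_power2)
    have cancel: "\<rho> * p * (\<rho> * q) / \<rho>^2 = p * q" for p q
      using \<rho>0 by (simp add: power2_eq_square)
    have "(\<rho> * g1 - m * y) * (\<rho> * d1 - n * y) + (\<rho> * g2 + m * x) * (\<rho> * d2 + n * x)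
        - (x * g1 + y * g2) * (x * d1 + y * d2) + m * n = g1 * d1 + g2 * d2"
      using mn \<rho>2 by algebra
    then show ?thesis
      unfolding im du sl2_metric_smooth rad rot cm cancel
      by (simp add: inner_complex_def gd)
  qed
  have rotate: "(z * cis \<psi>) \<bullet> (z' * cis \<psi>) = z \<bullet> z'" for z z' \<psi>
  proof -
    have "(z * cis \<psi>) \<bullet> (z' * cis \<psi>) = (z \<bullet> z') * ((cos \<psi>)^2 + (sin \<psi>)^2)"
      unfolding inner_complex_def times_complex.sel cis.sel by algebra
    then show ?thesis by simp
  qed
  have P: "(Complex x y, snd P) = P" by (simp add: prod_eq_iff xy)
  have "sl2_metric P (sl2_frame P v) (sl2_frame P w)
      = (fst v * cis (2 * snd P)) \<bullet> (fst w * cis (2 * snd P)) + snd v * snd w"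
    unfolding sl2_frame_def Let_def \<rho>_def[symmetric] unfolding xy by (rule core[unfolded P])
  then show ?thesis by (simp add: rotate inner_prod_def)
qed

lemma sl2_angle_frame: "sl2_angle P (sl2_frame P v) (sl2_frame P w) = vec_angle v w"
  unfolding sl2_angle_def vec_angle_def sl2_metric_frame norm_eq_sqrt_inner by simp

section \<open>Velocities of translation curves\<close>

text \<open>
  The projection to the hyperboloid is a local diffeomorphism. Near \<open>t\<close>, continuity of the lift
  keeps \<open>\<phi>\<close> within \<open>\<pi>\<close> of its value at \<open>t\<close>, so \<open>\<phi>\<close> is a branch of the argument of \<open>a\<close> there, which
  makes it differentiable with derivative \<open>Im (a' / a)\<close>; then \<open>u = b cis \<phi>\<close> is differentiable too.
\<close>

lemma continuous_lift_has_vector_derivative: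
  fixes c :: "real \<Rightarrow> sl2_cover"
  assumes cont: "continuous_on S c" and t: "t \<in> S"
    and a: "((\<lambda>t. sl2_a (c t)) has_vector_derivative a') (at t within S)"
    and b: "((\<lambda>t. sl2_b (c t)) has_vector_derivative b') (at t within S)"
    and \<phi>': "\<phi>' = Im (a' / sl2_a (c t))"
  shows "(c has_vector_derivative
    (b' * cis (snd (c t)) + sl2_b (c t) * (\<i> * of_real \<phi>' * cis (snd (c t))), \<phi>')) (at t within S)"
proof -
  define \<phi> where "\<phi> s = snd (c s)" for s
  define \<rho> where "\<rho> s = sqrt (1 + (cmod (fst (c s)))^2)" for s
  \<comment> \<open>The factor \<open>cis (- \<phi> t)\<close> rotates \<open>a\<close> to the positive real axis at time \<open>t\<close>, away from the
    branch cut of \<open>Ln\<close>.\<close>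
  define h where "h s = sl2_a (c s) * cis (- \<phi> t)" for s
  have \<rho>: "\<rho> s > 0" for s unfolding \<rho>_def by (simp add: add_pos_nonneg)
  have h_polar: "h s = exp (Complex (ln (\<rho> s)) (\<phi> s - \<phi> t))" for s
    using \<rho>[of s] unfolding h_def sl2_a_def \<phi>_def[symmetric] \<rho>_def[symmetric]
    by (simp add: exp_eq_polar mult.assoc cis_mult)
  have ht: "h t = of_real (\<rho> t)"
    unfolding h_def sl2_a_def \<phi>_def[symmetric] \<rho>_def[symmetric] by (simp add: mult.assoc cis_mult)
  have cont\<phi>: "continuous_on S \<phi>"
    unfolding \<phi>_def using cont by (intro continuous_intros)
  have "\<forall>e>0. \<exists>d>0. \<forall>s\<in>S. dist s t < d \<longrightarrow> dist (\<phi> s) (\<phi> t) < e"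
    using cont\<phi> t unfolding continuous_on_iff by blast
  then obtain d where d: "d > 0" "\<And>s. s \<in> S \<Longrightarrow> dist s t < d \<Longrightarrow> dist (\<phi> s) (\<phi> t) < pi"
    using pi_gt_zero by blast
  have "(h has_vector_derivative a' * cis (- \<phi> t)) (at t within S)"
    unfolding h_def by (rule has_vector_derivative_mult_left[OF a])
  moreover have "(Ln has_field_derivative inverse (h t)) (at (h t) within h ` S)"
    by (rule has_field_derivative_at_within, rule has_field_derivative_Ln)
       (use \<rho>[of t] in \<open>simp add: ht complex_nonpos_Reals_iff\<close>)
  ultimately have "((Ln \<circ> h) has_vector_derivative a' * cis (- \<phi> t) * inverse (h t)) (at t within S)"
    by (rule field_vector_diff_chain_within)
  moreover have "a' * cis (- \<phi> t) * inverse (h t) = a' / sl2_a (c t)"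
    unfolding h_def by (simp add: field_simps)
  ultimately have Ln': "((\<lambda>s. Im (Ln (h s)) + \<phi> t) has_vector_derivative \<phi>') (at t within S)"
    unfolding \<phi>' by (auto intro!: derivative_eq_intros simp: has_vector_derivative_complex_iff
        has_real_derivative_iff_has_vector_derivative o_def)
  have d\<phi>: "(\<phi> has_vector_derivative \<phi>') (at t within S)"
  proof (rule has_vector_derivative_transform_within[OF Ln' d(1) t])
    fix s assume "s \<in> S" "dist s t < d"
    then have "\<bar>\<phi> s - \<phi> t\<bar> < pi" using d(2) by (simp add: dist_real_def)
    then have "Ln (h s) = Complex (ln (\<rho> s)) (\<phi> s - \<phi> t)"
      unfolding h_polar by (intro Ln_exp) auto
    then show "Im (Ln (h s)) + \<phi> t = \<phi> s" by simp
  qed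
  have "((\<lambda>s. cis (\<phi> s)) has_vector_derivative \<i> * of_real \<phi>' * cis (\<phi> t)) (at t within S)"
    using d\<phi> unfolding has_vector_derivative_def
    by (auto intro!: derivative_eq_intros simp: scaleR_conv_of_real mult_ac fun_eq_iff)
  from has_vector_derivative_mult[OF b this]
  have "((\<lambda>s. sl2_b (c s) * cis (\<phi> s)) has_vector_derivative
      (b' * cis (\<phi> t) + sl2_b (c t) * (\<i> * of_real \<phi>' * cis (\<phi> t)))) (at t within S)"
    by (simp add: add.commute)
  moreover have "sl2_b (c s) * cis (\<phi> s) = fst (c s)" for s
    unfolding sl2_b_def \<phi>_def by (simp add: mult.assoc cis_mult)
  ultimately have "((\<lambda>s. fst (c s)) has_vector_derivative
      (b' * cis (\<phi> t) + sl2_b (c t) * (\<i> * of_real \<phi>' * cis (\<phi> t)))) (at t within S)" by simp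
  from has_vector_derivative_Pair[OF this d\<phi>] show ?thesis
    unfolding \<phi>_def by simp
qed

text \<open>
  The velocity of \<open>c\<close> is the right translate of \<open>w = (\<beta>, v)\<close>, written in matrix entries. Here
  \<open>(i v, \<beta>)\<close> is the velocity at the identity; its \<open>a\<close>-component has no real part because it is
  tangent to the hyperboloid.
\<close>

definition invariant_velocity :: "complex \<times> real \<Rightarrow> (real \<Rightarrow> sl2_cover) \<Rightarrow> bool" where
  "invariant_velocity w c \<longleftrightarrow> (\<forall>t\<ge>0.
     ((\<lambda>t. sl2_a (c t)) has_vector_derivative
        \<i> * of_real (snd w) * sl2_a (c t) + cnj (fst w) * sl2_b (c t)) (at t within {0..}) \<and>
     ((\<lambda>t. sl2_b (c t)) has_vector_derivative
        cnj (\<i> * of_real (snd w)) * sl2_b (c t) + fst w * sl2_a (c t)) (at t within {0..}))"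

lemma frame_velocity:
  assumes cont: "continuous_on {0..} c" and vel: "invariant_velocity w c" and t: "t \<ge> 0"
  shows "(c has_vector_derivative sl2_frame (c t) w) (at t within {0..})"
proof -
  define u where "u = fst (c t)"
  define \<phi> where "\<phi> = snd (c t)"
  define \<rho> where "\<rho> = sqrt (1 + (cmod u)^2)"
  define \<gamma> where "\<gamma> = fst w * cis (2 * \<phi>)"
  define m where "m = Im (cnj \<gamma> * u) / \<rho>"
  have \<rho>: "\<rho> > 0" unfolding \<rho>_def by (simp add: add_pos_nonneg)
  define a where "a = sl2_a (c t)"
  define b where "b = sl2_b (c t)"
  have a: "a = of_real \<rho> * cis \<phi>" and b: "b = u * cis (- \<phi>)"
    by (simp_all add: a_def b_def sl2_a_def sl2_b_def u_def \<phi>_def \<rho>_def)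
  have "b / a = u * (cis (- \<phi>) / cis \<phi>) / of_real \<rho>" by (simp add: a b)
  also have "cis (- \<phi>) / cis \<phi> = cnj (cis (2 * \<phi>))" by (simp add: cis_divide cis_cnj)
  finally have ba: "b / a = u * cnj (cis (2 * \<phi>)) / of_real \<rho>" .
  have cis2: "cis (2 * \<phi>) = cis \<phi> * cis \<phi>" by (simp add: cis_mult)
  have "a \<noteq> 0" using \<rho> by (simp add: a)
  then have "(\<i> * of_real (snd w) * a + cnj (fst w) * b) / a
      = \<i> * of_real (snd w) + cnj (fst w) * (b / a)"
    by (simp add: add_divide_distrib)
  also have "\<dots> = \<i> * of_real (snd w) + cnj \<gamma> * u / of_real \<rho>"
    unfolding ba by (simp add: \<gamma>_def mult_ac)
  finally have "(\<i> * of_real (snd w) * a + cnj (fst w) * b) / a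
      = \<i> * of_real (snd w) + cnj \<gamma> * u / of_real \<rho>" .
  then have \<phi>': "snd w + m = Im ((\<i> * of_real (snd w) * a + cnj (fst w) * b) / a)"
    by (simp add: m_def Im_divide_of_real)
  have bc: "b * cis \<phi> = u" by (simp add: b mult.assoc cis_mult)
  have "(cnj (\<i> * of_real (snd w)) * b + fst w * a) * cis \<phi> + b * (\<i> * of_real (snd w + m) * cis \<phi>)
     = (- \<i> * of_real (snd w)) * (b * cis \<phi>) + fst w * of_real \<rho> * (cis \<phi> * cis \<phi>)
       + \<i> * of_real (snd w + m) * (b * cis \<phi>)"
    by (simp add: a algebra_simps)
  also have "\<dots> = of_real \<rho> * \<gamma> + \<i> * of_real m * u"
    unfolding bc cis2[symmetric] by (simp add: \<gamma>_def algebra_simps)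
  finally have "(of_real \<rho> * \<gamma> + \<i> * of_real m * u, snd w + m) =
     ((cnj (\<i> * of_real (snd w)) * b + fst w * a) * cis \<phi> + b * (\<i> * of_real (snd w + m) * cis \<phi>), snd w + m)"
    by simp
  moreover have "sl2_frame (c t) w = (of_real \<rho> * \<gamma> + \<i> * of_real m * u, snd w + m)"
    unfolding sl2_frame_def Let_def u_def \<phi>_def \<rho>_def \<gamma>_def m_def by simp
  moreover have "(c has_vector_derivative
     ((cnj (\<i> * of_real (snd w)) * b + fst w * a) * cis \<phi> + b * (\<i> * of_real (snd w + m) * cis \<phi>), snd w + m))
     (at t within {0..})"
    unfolding b_def \<phi>_def
    by (rule continuous_lift_has_vector_derivative[OF cont])
       (use vel t \<phi>' in \<open>auto simp: invariant_velocity_def a_def b_def\<close>)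
  ultimately show ?thesis by simp
qed

text \<open>
  The differential equation that defines translation curves is right-invariance of the velocity.
  What remains is that the initial velocity \<open>V\<close> is tangent to the hyperboloid at the origin, i.e.
  \<open>V $ 1 = 0\<close>; this follows by differentiating the form along the curve.
\<close>

lemma velocity_from_origin:
  assumes "translation_curve_from_origin c"
  shows "\<exists>w. invariant_velocity w c"
proof -
  define C where "C t = sl2_proj (c t)" for t
  have C0: "C 0 = sl2_E0" and hyp: "\<And>t. t \<ge> 0 \<Longrightarrow> sl2_form (C t) = -1"
    using assms
    unfolding translation_curve_from_origin_def hyperboloid_translation_curve_def C_def
      sl2_hyperboloid_def by auto
  obtain V where V0: "(C has_vector_derivative V) (at 0 within {0..})"
    and V: "\<And>t. t \<ge> 0 \<Longrightarrow> (C has_vector_derivative (V v* sl2_T (C t))) (at t within {0..})"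
    using assms
    unfolding translation_curve_from_origin_def hyperboloid_translation_curve_def C_def by auto
  have nth: "((\<lambda>t. C t $ i) has_vector_derivative W $ i) (at t within {0..})"
    if "(C has_vector_derivative W) (at t within {0..})" for W t i
    using bounded_linear.has_vector_derivative[OF bounded_linear_vec_nth that] .
  have V1: "V $ 1 = 0"
  proof -
    have "((\<lambda>t. sl2_form (C t)) has_vector_derivative - 2 * V $ 1) (at 0 within {0..})"
      unfolding sl2_form_def power2_eq_square
      by (rule derivative_eq_intros refl nth[OF V0])+ (simp add: C0 sl2_E0_def)
    moreover have "((\<lambda>t. sl2_form (C t)) has_vector_derivative 0) (at 0 within {0..})"
      by (rule has_vector_derivative_transform[where f = "\<lambda>_. -1"]) (auto simp: hyp)
    moreover have "at (0::real) within {0..} \<noteq> bot"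
      by (simp add: at_within_Ici_at_right)
    ultimately have "- 2 * V $ 1 = 0"
      using vector_derivative_unique_within by blast
    then show ?thesis by simp
  qed
  define w where "w = (Complex (V $ 3) (V $ 4), V $ 2)"
  have eq: "(V v* sl2_T (C t)) $ 1 = Re (\<i> * of_real (snd w) * sl2_a (c t) + cnj (fst w) * sl2_b (c t))"
    "(V v* sl2_T (C t)) $ 2 = Im (\<i> * of_real (snd w) * sl2_a (c t) + cnj (fst w) * sl2_b (c t))"
    "(V v* sl2_T (C t)) $ 3 = Re (cnj (\<i> * of_real (snd w)) * sl2_b (c t) + fst w * sl2_a (c t))"
    "(V v* sl2_T (C t)) $ 4 = Im (cnj (\<i> * of_real (snd w)) * sl2_b (c t) + fst w * sl2_a (c t))" for t
    unfolding vector_matrix_mult_def sl2_T_def w_def C_def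
    by (simp_all add: sum_4 sl2_proj_ab V1)
  have "invariant_velocity w c"
    unfolding invariant_velocity_def has_vector_derivative_complex_iff sl2_proj_ab[symmetric] eq[symmetric]
      has_real_derivative_iff_has_vector_derivative
    using nth[OF V] by (simp add: C_def)
  then show ?thesis ..
qed

text \<open>
  Right multiplication by \<open>P\<close> commutes with the left multiplication by the velocity at the identity
  that appears in \<open>invariant_velocity\<close>, so the differential equation survives the translation with
  the same \<open>w\<close>.
\<close>

lemma velocity_translation_curve:
  assumes "translation_curve P c"
  shows "\<exists>w. continuous_on {0..} c \<and> invariant_velocity w c"
proof -
  obtain \<tau> c0 where \<tau>: "sl2_translation P \<tau>" and c0: "translation_curve_from_origin c0"
    and c: "\<And>t. t \<ge> 0 \<Longrightarrow> c t = \<tau> (c0 t)"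
    using assms unfolding translation_curve_def by blast
  obtain w where w: "invariant_velocity w c0" using velocity_from_origin[OF c0] ..
  have ab: "sl2_a (c t) = sl2_a (c0 t) * sl2_a P + cnj (sl2_b (c0 t)) * sl2_b P"
    "sl2_b (c t) = cnj (sl2_a (c0 t)) * sl2_b P + sl2_b (c0 t) * sl2_a P" if "t \<ge> 0" for t
  proof -
    have "sl2_proj (c t) = sl2_proj (c0 t) v* sl2_T (sl2_proj P)"
      unfolding c[OF that] using \<tau> unfolding sl2_translation_def by blast
    then show "sl2_a (c t) = sl2_a (c0 t) * sl2_a P + cnj (sl2_b (c0 t)) * sl2_b P"
      "sl2_b (c t) = cnj (sl2_a (c0 t)) * sl2_b P + sl2_b (c0 t) * sl2_a P"
      unfolding sl2_proj_T_iff by simp_all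
  qed
  have "continuous_on {0..} (\<lambda>t. \<tau> (c0 t))"
  proof (rule continuous_on_compose2[of UNIV \<tau>])
    show "continuous_on UNIV \<tau>" using \<tau> unfolding sl2_translation_def by (rule conjunct1)
    show "continuous_on {0..} c0"
      using c0 unfolding translation_curve_from_origin_def by (rule conjunct1)
  qed simp
  then have "continuous_on {0..} c" by (rule continuous_on_eq) (simp add: c)
  moreover have "invariant_velocity w c"
    unfolding invariant_velocity_def
  proof (intro allI impI conjI)
    fix t :: real assume t: "t \<ge> 0"
    note da = conjunct1[OF w[unfolded invariant_velocity_def, rule_format, OF t]]
    note db = conjunct2[OF w[unfolded invariant_velocity_def, rule_format, OF t]]
    show "((\<lambda>t. sl2_a (c t)) has_vector_derivative
        \<i> * of_real (snd w) * sl2_a (c t) + cnj (fst w) * sl2_b (c t)) (at t within {0..})"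
    proof (rule has_vector_derivative_transform)
      show "((\<lambda>t. sl2_a (c0 t) * sl2_a P + cnj (sl2_b (c0 t)) * sl2_b P) has_vector_derivative
        \<i> * of_real (snd w) * sl2_a (c t) + cnj (fst w) * sl2_b (c t)) (at t within {0..})"
        unfolding ab[OF t]
        by (rule has_vector_derivative_eq_rhs[OF has_vector_derivative_add[OF
          has_vector_derivative_mult_left[OF da]
          has_vector_derivative_mult_left[OF has_vector_derivative_cnj[OF db]]]])
          (simp add: algebra_simps)
    qed (use t in \<open>simp_all add: ab\<close>)
    show "((\<lambda>t. sl2_b (c t)) has_vector_derivative
        cnj (\<i> * of_real (snd w)) * sl2_b (c t) + fst w * sl2_a (c t)) (at t within {0..})"
    proof (rule has_vector_derivative_transform)
      show "((\<lambda>t. cnj (sl2_a (c0 t)) * sl2_b P + sl2_b (c0 t) * sl2_a P) has_vector_derivative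
        cnj (\<i> * of_real (snd w)) * sl2_b (c t) + fst w * sl2_a (c t)) (at t within {0..})"
        unfolding ab[OF t]
        by (rule has_vector_derivative_eq_rhs[OF has_vector_derivative_add[OF
          has_vector_derivative_mult_left[OF has_vector_derivative_cnj[OF da]]
          has_vector_derivative_mult_left[OF db]]])
          (simp add: algebra_simps)
    qed (use t in \<open>simp_all add: ab\<close>)
  qed
  ultimately show ?thesis by blast
qed

lemma translation_curve_start: "translation_curve P c \<Longrightarrow> c 0 = P"
  unfolding translation_curve_def translation_curve_from_origin_def sl2_translation_def
  by (metis order_refl)

text \<open>
  One vector \<open>w\<close> serves both ends of a side; the sign at \<open>Q\<close> is there because both tangents point
  into the side.
\<close>

lemma side_tangents:
  assumes "translation_side P Q s"
  obtains w where "side_tangent_start s = sl2_frame P w" "side_tangent_end s = sl2_frame Q (- w)"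
proof -
  have c: "translation_curve P (fst s)" and L: "0 < snd s" and Q: "fst s (snd s) = Q"
    using assms by (simp_all add: translation_side_def)
  obtain w where cont: "continuous_on {0..} (fst s)" and w: "invariant_velocity w (fst s)"
    using velocity_translation_curve[OF c] by blast
  have *: "vector_derivative (fst s) (at t within {0..snd s}) = sl2_frame (fst s t) w"
    if "t \<in> {0..snd s}" for t
  proof (rule vector_derivative_within_closed_interval[OF L that])
    show "(fst s has_vector_derivative sl2_frame (fst s t) w) (at t within {0..snd s})"
      using frame_velocity[OF cont w] that
      by (auto intro: has_vector_derivative_within_subset[where S = "{0..}"])
  qed
  have "side_tangent_start s = sl2_frame P w" "side_tangent_end s = sl2_frame Q (- w)"
    using *[of 0] *[of "snd s"] L translation_curve_start[OF c]
    by (simp_all add: side_tangent_start_def side_tangent_end_def sl2_frame_minus Q)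
  then show thesis by (rule that)
qed

section \<open>The angle sum\<close>

theorem theorem4p6:
  fixes A1 A2 A3 :: sl2_cover and s12 s23 s31 :: sl2_side
  assumes "translation_triangle A1 A2 A3 s12 s23 s31"
  shows "interior_angle A1 s31 s12 + interior_angle A2 s12 s23 + interior_angle A3 s23 s31 \<ge> pi"
proof -
  have sides: "translation_side A1 A2 s12" "translation_side A2 A3 s23" "translation_side A3 A1 s31"
    using assms by (simp_all add: translation_triangle_def)
  obtain u where u: "side_tangent_start s12 = sl2_frame A1 u" "side_tangent_end s12 = sl2_frame A2 (- u)"
    using side_tangents[OF sides(1)] .
  obtain v where v: "side_tangent_start s23 = sl2_frame A2 v" "side_tangent_end s23 = sl2_frame A3 (- v)"
    using side_tangents[OF sides(2)] .
  obtain w where w: "side_tangent_start s31 = sl2_frame A3 w" "side_tangent_end s31 = sl2_frame A1 (- w)"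
    using side_tangents[OF sides(3)] .
  have "interior_angle A1 s31 s12 + interior_angle A2 s12 s23 + interior_angle A3 s23 s31
      = 3 * pi - (vec_angle u v + vec_angle v w + vec_angle w u)"
    unfolding interior_angle_def u v w sl2_angle_frame vec_angle_minus_left by simp
  then show ?thesis using vec_angle_sum_le[of u v w] by linarith
qed

end
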